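(* Let $Q=\mathrm{diag}(\lambda_1,\dots,\lambda_d)$ be positive definite, $w^\star\in\mathbb{R}^d$, $\mathcal L(w)=\mathbb E_{x\sim\mathcal N(0,Q)}\big[((x^\top w)^2-(x^\top w^\star)^2)^2\big]$, and let $w(t)$ satisfy the gradient flow $\dot w(t)=-\nabla\mathcal L(w(t))$. For integers $k\ge1$ put $s^{(k)}(t)=w(t)^\top Q^kw(t)$, $s_\star^{(k)}=(w^\star)^\top Q^kw^\star$, $u^{(k)}(t)=w(t)^\top Q^kw^\star$, and $s=s^{(1)}$, $u=u^{(1)}$, $s_\star=s_\star^{(1)}$. Then, for $i=1,\dots,d$ and all $k\ge1$, $$\dot w_i(t)=4\lambda_i\big(s_\star-3s(t)\big)w_i(t)+8\lambda_iu(t)w_i^\star,$$ $$\dot s^{(k)}(t)=8\big(s_\star-3s(t)\big)s^{(k+1)}(t)+16\,u(t)\,u^{(k+1)}(t),$$ $$\dot u^{(k)}(t)=4\big(s_\star-3s(t)\big)u^{(k+1)}(t)+8\,u(t)\,s_\star^{(k+1)}.$$ In particular, $k=1$ gives the dynamics of $s(t)$ and $u(t)$.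
   Context: No further definitions are needed. *)

theory Defs
  imports "HOL-Analysis.Analysis"
begin

definition diag_matrix :: "'a::zero ^ 'n \<Rightarrow> 'a ^ 'n ^ 'n"
  where "diag_matrix v = (\<chi> i j. if i = j then v $ i else 0)"

definition positive_definite :: "real ^ 'n ^ 'n \<Rightarrow> bool"
  where "positive_definite A \<longleftrightarrow> transpose A = A \<and> (\<forall>x. x \<noteq> 0 \<longrightarrow> x \<bullet> (A *v x) > 0)"

text \<open>The overloaded power operator on \<open>real ^ 'n ^ 'n\<close> is componentwise,
  so powers for the matrix product need their own constant.\<close>

primrec matrix_power :: "'a::semiring_1 ^ 'n ^ 'n \<Rightarrow> nat \<Rightarrow> 'a ^ 'n ^ 'n"
  where
    "matrix_power A 0 = mat 1"
  | "matrix_power A (Suc k) = A ** matrix_power A k"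

text \<open>The Gaussian law with mean \<open>m\<close> and covariance \<open>S\<close>, through its Lebesgue density;
  meaningful only for positive definite \<open>S\<close>.\<close>

definition multivariate_normal :: "real ^ 'n \<Rightarrow> real ^ 'n ^ 'n \<Rightarrow> (real ^ 'n) measure"
  where "multivariate_normal m S = density lborel (\<lambda>x. ennreal
    (exp (- ((x - m) \<bullet> (matrix_inv S *v (x - m))) / 2) / sqrt ((2 * pi) ^ CARD('n) * det S)))"

definition gradient :: "('a::real_inner \<Rightarrow> real) \<Rightarrow> 'a \<Rightarrow> 'a"
  where "gradient f x = (THE D. GDERIV f x :> D)"

lemma gradient_eqI:
  assumes "GDERIV f x :> D"
  shows "gradient f x = D"
  unfolding gradient_def
proof (rule the_equality)
  show "GDERIV f x :> D" by fact
next
  fix E assume "GDERIV f x :> E"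
  then have "(\<lambda>h. h \<bullet> E) = (\<lambda>h. h \<bullet> D)"
    using assms unfolding gderiv_def by (rule has_derivative_unique)
  then have "(E - D) \<bullet> E = (E - D) \<bullet> D" by (rule fun_cong)
  then have "(E - D) \<bullet> (E - D) = 0" by (simp add: inner_diff_right)
  then show "E = D" by simp
qed

definition population_loss :: "real ^ 'n ^ 'n \<Rightarrow> real ^ 'n \<Rightarrow> real ^ 'n \<Rightarrow> real"
  where "population_loss Q wstar w =
    (\<integral>x. ((x \<bullet> w)\<^sup>2 - (x \<bullet> wstar)\<^sup>2)\<^sup>2 \<partial>multivariate_normal 0 Q)"

end

theory Submission
  imports Defs "HOL-Probability.Distributions"
begin

text \<open>For \<open>x\<close> with law \<open>N(0, Q)\<close>, \<open>Q\<close> diagonal, \<open>x \<bullet> w\<close> is a sum of independent centred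
  normal variables, hence normal with variance \<open>q(w) = w \<bullet> Q w\<close>, and \<open>E (x \<bullet> w) ^ 4 = 3 q(w)\<^sup>2\<close>.
  By polarisation, the integrand of the loss is a linear combination of the fourth powers of
  \<open>x \<bullet> w\<close>, \<open>x \<bullet> wstar\<close>, \<open>x \<bullet> (w + wstar)\<close> and \<open>x \<bullet> (w - wstar)\<close>, so the loss is an explicit
  quartic polynomial in \<open>w\<close>. Inserting its gradient into the flow gives the equation for \<open>w\<close>;
  the other two follow by the product rule.\<close>

section \<open>Product measures: densities and independent coordinates\<close>

text \<open>A measure on a finite product of sigma-finite spaces is determined by its values on
  boxes. On a box the integrand splits into one factor per coordinate, and Tonelli turns the
  integral into the product of the marginal ones.\<close>

lemma density_PiM:
  assumes I: "finite I"
    and M: "\<And>i. i \<in> I \<Longrightarrow> sigma_finite_measure (M i)"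
    and f [measurable]: "\<And>i. i \<in> I \<Longrightarrow> f i \<in> borel_measurable (M i)"
    and prob: "\<And>i. i \<in> I \<Longrightarrow> prob_space (density (M i) (f i))"
  shows "density (PiM I M) (\<lambda>x. \<Prod>i\<in>I. f i (x i)) = PiM I (\<lambda>i. density (M i) (f i))"
proof -
  \<comment> \<open>The library's product rules ask for \<open>\<sigma>\<close>-finiteness outside \<open>I\<close> too.\<close>
  define M' where "M' i = (if i \<in> I then M i else return (count_space UNIV) undefined)" for i
  define N where "N i = (if i \<in> I then density (M i) (f i) else return (count_space UNIV) undefined)" for i
  interpret M: product_sigma_finite M'
    using M by (auto simp: M'_def product_sigma_finite_def
        intro!: prob_space_imp_sigma_finite prob_space_return)
  interpret N: product_sigma_finite N
    using prob by (auto simp: N_def product_sigma_finite_def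
        intro!: prob_space_imp_sigma_finite prob_space_return)
  have MM: "PiM I M = PiM I M'" and NN: "PiM I (\<lambda>i. density (M i) (f i)) = PiM I N"
    by (auto simp: M'_def N_def intro!: PiM_cong)
  have [measurable]: "(\<lambda>x. \<Prod>i\<in>I. f i (x i)) \<in> borel_measurable (PiM I M)"
    by measurable
  have "PiM I N = density (PiM I M) (\<lambda>x. \<Prod>i\<in>I. f i (x i))"
  proof (rule N.PiM_eqI[symmetric, OF I])
    show "sets (density (PiM I M) (\<lambda>x. \<Prod>i\<in>I. f i (x i))) = sets (PiM I N)"
      by (auto simp: N_def intro!: sets_PiM_cong)
  next
    fix A assume A: "\<And>i. i \<in> I \<Longrightarrow> A i \<in> sets (N i)"
    then have A' [measurable]: "A i \<in> sets (M i)" if "i \<in> I" for i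
      using A[OF that] that by (simp add: N_def)
    have "emeasure (density (PiM I M) (\<lambda>x. \<Prod>i\<in>I. f i (x i))) (Pi\<^sub>E I A)
        = (\<integral>\<^sup>+x. (\<Prod>i\<in>I. f i (x i)) * indicator (Pi\<^sub>E I A) x \<partial>PiM I M)"
      using I by (subst emeasure_density) (auto intro!: sets_PiM_I_finite)
    \<comment> \<open>Points of \<open>space (PiM I M)\<close> are extensional, so there the
      indicator of \<open>Pi\<^sub>E I A\<close> is the product of the indicators of the sets
      \<open>A i\<close>.\<close>
    also have "\<dots> = (\<integral>\<^sup>+x. (\<Prod>i\<in>I. f i (x i) * indicator (A i) (x i)) \<partial>PiM I M)"
      by (intro nn_integral_cong)
        (auto simp: prod.distrib space_PiM PiE_def Pi_def indicator_def I
          split: if_splits)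
    also have "\<dots> = (\<Prod>i\<in>I. \<integral>\<^sup>+x. f i x * indicator (A i) x \<partial>M' i)"
      unfolding MM using I by (subst M.product_nn_integral_prod) (auto simp: M'_def)
    also have "\<dots> = (\<Prod>i\<in>I. emeasure (N i) (A i))"
      by (intro prod.cong) (auto simp: M'_def N_def emeasure_density)
    finally show "emeasure (density (PiM I M) (\<lambda>x. \<Prod>i\<in>I. f i (x i))) (Pi\<^sub>E I A)
        = (\<Prod>i\<in>I. emeasure (N i) (A i))" .
  qed
  then show ?thesis by (simp add: NN)
qed

text \<open>The joint law of all coordinates is the law of the identity map, hence the product of
  the marginal laws. The empty index set is split off because this characterisation of independence
  requires a nonempty one.\<close>

lemma indep_vars_PiM_components:
  assumes M: "\<And>i. i \<in> I \<Longrightarrow> prob_space (M i)"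
  shows "prob_space.indep_vars (PiM I M) M (\<lambda>i \<omega>. \<omega> i) I"
proof -
  interpret prob_space "PiM I M"
    using M by (rule prob_space_PiM)
  show ?thesis
  proof (cases "I = {}")
    case True
    then show ?thesis
      unfolding indep_vars_def indep_sets_def by (simp add: True)
  next
    case False
    have "distr (PiM I M) (PiM I M) (\<lambda>\<omega>. restrict \<omega> I) = distr (PiM I M) (PiM I M) (\<lambda>\<omega>. \<omega>)"
      by (intro distr_cong) (auto simp: space_PiM PiE_def extensional_restrict)
    moreover have "PiM I (\<lambda>i. distr (PiM I M) (M i) (\<lambda>\<omega>. \<omega> i)) = PiM I M"
      using M by (intro PiM_cong refl distr_PiM_component)
    ultimately show ?thesis
      using False by (subst indep_vars_iff_distr_eq_PiM') auto
  qed
qed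

section \<open>Centred Gaussians with diagonal covariance and their fourth moments\<close>

text \<open>The parameter is a standard deviation per basis vector. Indexing by \<open>Basis\<close>
  matches \<open>lborel_eq\<close>, which presents \<open>lborel\<close> as the image of a product
  of one-dimensional Lebesgue measures.\<close>

definition diag_normal :: "('a::euclidean_space \<Rightarrow> real) \<Rightarrow> 'a measure" where
  "diag_normal \<sigma> = density lborel (\<lambda>x. ennreal (\<Prod>b\<in>Basis. normal_density 0 (\<sigma> b) (x \<bullet> b)))"

lemma diag_normal_eq_distr:
  fixes \<sigma> :: "'a::euclidean_space \<Rightarrow> real"
  assumes "\<And>b. b \<in> Basis \<Longrightarrow> 0 < \<sigma> b"
  shows "diag_normal \<sigma> = distr (\<Pi>\<^sub>M b\<in>Basis. density lborel (normal_density 0 (\<sigma> b)))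
    borel (\<lambda>f. \<Sum>b\<in>Basis. f b *\<^sub>R b)"
proof -
  have "diag_normal \<sigma> = distr (density (\<Pi>\<^sub>M b\<in>Basis. lborel)
      (\<lambda>f. ennreal (\<Prod>b\<in>Basis. normal_density 0 (\<sigma> b) ((\<Sum>b\<in>Basis. f b *\<^sub>R b) \<bullet> b))))
      borel (\<lambda>f. \<Sum>b\<in>Basis. f b *\<^sub>R b)"
    unfolding diag_normal_def by (subst lborel_eq, subst density_distr) simp_all
  also have "(\<lambda>f. ennreal (\<Prod>b\<in>Basis. normal_density 0 (\<sigma> b) ((\<Sum>b\<in>Basis. f b *\<^sub>R b) \<bullet> b)))
      = (\<lambda>f. \<Prod>b::'a\<in>Basis. ennreal (normal_density 0 (\<sigma> b) (f b)))"
    by (auto simp: fun_eq_iff prod_ennreal inner_sum_left inner_Basis if_distrib sum.If_cases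
        intro!: arg_cong[where f=ennreal] prod.cong)
  also have "density (\<Pi>\<^sub>M b\<in>Basis. lborel) \<dots>
      = (\<Pi>\<^sub>M b\<in>Basis. density lborel (normal_density 0 (\<sigma> b)))"
    using assms by (intro density_PiM)
      (auto intro: prob_space_normal_density lborel.sigma_finite_measure_axioms)
  finally show ?thesis .
qed


lemma (in prob_space) normal_fourth_moment:
  assumes "distributed M lborel X (normal_density 0 \<sigma>)" and "0 < \<sigma>"
  shows "has_bochner_integral M (\<lambda>x. X x ^ 4) (3 * \<sigma> ^ 4)"
proof -
  have "has_bochner_integral lborel (\<lambda>x. normal_density 0 \<sigma> x * x ^ 4) (3 * \<sigma> ^ 4)"
    \<comment> \<open>The moment of order 2k with k = 2: 4! / ((2 / \<sigma>^2)^2 * 2!) = 3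
      \<sigma>^4.\<close>
    using normal_moment_even[OF assms(2), of 0 2]
    by (simp add: fact_numeral field_simps eval_nat_numeral)
  then show ?thesis
    using distributed_integrable[OF assms(1), of "\<lambda>x. x ^ 4"]
      distributed_integral[OF assms(1), of "\<lambda>x. x ^ 4"]
    by (simp add: has_bochner_integral_iff)
qed

lemma diag_normal_fourth_moment:
  fixes \<sigma> :: "'a::euclidean_space \<Rightarrow> real"
  assumes \<sigma>: "\<And>b. b \<in> Basis \<Longrightarrow> 0 < \<sigma> b"
  shows "has_bochner_integral (diag_normal \<sigma>) (\<lambda>x. (x \<bullet> w) ^ 4)
    (3 * (\<Sum>b\<in>Basis. (\<sigma> b)\<^sup>2 * (w \<bullet> b)\<^sup>2)\<^sup>2)"
proof -
  let ?N = "\<lambda>b::'a. density lborel (normal_density 0 (\<sigma> b))"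
  let ?P = "PiM Basis ?N"
  \<comment> \<open>Directions orthogonal to \<open>w\<close> contribute the constant 0, which has
    no normal density; \<open>J\<close> keeps only the nondegenerate summands.\<close>
  define J where "J = {b\<in>Basis. w \<bullet> b \<noteq> 0}"
  have J: "finite J" "J \<subseteq> Basis" by (auto simp: J_def)
  have N: "prob_space (?N b)" if "b \<in> Basis" for b
    using \<sigma>[OF that] by (rule prob_space_normal_density)
  interpret P: prob_space ?P using N by (rule prob_space_PiM)
  have comp: "P.indep_vars (\<lambda>_. borel) (\<lambda>b f. (w \<bullet> b) * f b) J"
  proof -
    have "P.indep_vars ?N (\<lambda>b f. f b) J"
      using indep_vars_PiM_components[of Basis ?N, OF N] J(2) by (rule P.indep_vars_subset)
    then show ?thesis
      by (rule P.indep_vars_compose2) simp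
  qed
  have normal: "distributed ?P lborel (\<lambda>f. (w \<bullet> b) * f b)
      (normal_density 0 (\<bar>w \<bullet> b\<bar> * \<sigma> b))" if "b \<in> J" for b
  proof -
    have b: "b \<in> Basis" "w \<bullet> b \<noteq> 0" using that by (auto simp: J_def)
    \<comment> \<open>\<open>distributed\<close> is wanted over \<open>lborel\<close>, while the
      component rule has target \<open>?N b\<close>; the two have the same measurable sets, so the
      image measure is the same.\<close>
    have "distr ?P lborel (\<lambda>f. f b) = distr ?P (?N b) (\<lambda>f. f b)"
      by (intro distr_cong) auto
    also have "\<dots> = ?N b"
      using N b by (intro distr_PiM_component)
    finally have "distributed ?P lborel (\<lambda>f. f b) (normal_density 0 (\<sigma> b))"
      using b by (simp add: distributed_def)
    from P.normal_density_affine[OF this \<sigma>[OF b(1)] b(2), of 0] show ?thesis by simp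
  qed
  have inner: "(\<Sum>b\<in>Basis. f b *\<^sub>R b) \<bullet> w = (\<Sum>b\<in>J. (w \<bullet> b) * f b)" for f
    unfolding inner_sum_left
    by (rule sum.mono_neutral_cong_right) (auto simp: J_def inner_commute)
  have var: "(\<Sum>b\<in>Basis. (\<sigma> b)\<^sup>2 * (w \<bullet> b)\<^sup>2) = (\<Sum>b\<in>J. (\<bar>w \<bullet> b\<bar> * \<sigma> b)\<^sup>2)"
    by (rule sum.mono_neutral_cong_right) (auto simp: J_def power_mult_distrib)
  have "has_bochner_integral ?P (\<lambda>f. ((\<Sum>b\<in>Basis. f b *\<^sub>R b) \<bullet> w) ^ 4)
    (3 * (\<Sum>b\<in>Basis. (\<sigma> b)\<^sup>2 * (w \<bullet> b)\<^sup>2)\<^sup>2)"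
  \<comment> \<open>\<open>sum_indep_normal\<close> needs a nonempty index set. If \<open>J\<close>
    is empty, the inner product and the claimed moment are both 0.\<close>
  proof (cases "J = {}")
    case True
    then show ?thesis unfolding inner var by (simp add: has_bochner_integral_zero)
  next
    case False
    let ?v = "\<Sum>b\<in>J. (\<bar>w \<bullet> b\<bar> * \<sigma> b)\<^sup>2"
    have pos: "0 < \<bar>w \<bullet> b\<bar> * \<sigma> b" if "b \<in> J" for b
      using that \<sigma> by (auto simp: J_def)
    have v: "0 < ?v"
      using J(1) False pos by (intro sum_pos zero_less_power)
    have "distributed ?P lborel (\<lambda>f. \<Sum>b\<in>J. (w \<bullet> b) * f b) (normal_density 0 (sqrt ?v))"
      using P.sum_indep_normal[OF J(1) False comp pos normal] by simp
    from P.normal_fourth_moment[OF this] v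
    have "has_bochner_integral ?P (\<lambda>f. (\<Sum>b\<in>J. (w \<bullet> b) * f b) ^ 4) (3 * sqrt ?v ^ 4)"
      by simp
    also have "sqrt ?v ^ 4 = (sqrt ?v ^ 2) ^ 2" by (simp flip: power_mult)
    also have "\<dots> = ?v\<^sup>2" using v by simp
    finally show ?thesis unfolding inner var .
  qed
  then show ?thesis
    using \<sigma> by (subst diag_normal_eq_distr; simp add: has_bochner_integral_distr)
qed

section \<open>Diagonal matrices and the matrix form of the Gaussian\<close>

lemma diag_matrix_vector_mult: "diag_matrix v *v x = (\<chi> i. v $ i * x $ i)"
  for v :: "'a::semiring_1 ^ 'n"
  by (simp add: vec_eq_iff matrix_vector_mult_def diag_matrix_def if_distrib if_distribR
      cong: if_cong)

lemma matrix_power_diag_matrix_vector_mult: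
  "matrix_power (diag_matrix v) k *v x = (\<chi> i. v $ i ^ k * x $ i)"
  for v :: "'a::comm_semiring_1 ^ 'n"
  by (induction k)
    (simp_all add: diag_matrix_vector_mult vec_eq_iff mult_ac flip: matrix_vector_mul_assoc)

lemma inner_diag_matrix: "x \<bullet> (diag_matrix v *v y) = (\<Sum>i\<in>UNIV. v $ i * x $ i * y $ i)"
  for v :: "real ^ 'n"
  by (simp add: diag_matrix_vector_mult inner_vec_def mult_ac)

lemma inner_matrix_power_diag_matrix:
  "x \<bullet> (matrix_power (diag_matrix v) k *v y) = (\<Sum>i\<in>UNIV. v $ i ^ k * x $ i * y $ i)"
  for v :: "real ^ 'n"
  by (simp add: matrix_power_diag_matrix_vector_mult inner_vec_def mult_ac)

lemma positive_definite_diag_matrixD: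
  assumes "positive_definite (diag_matrix v)"
  shows "0 < v $ i"
proof -
  have "axis i 1 \<bullet> (diag_matrix v *v axis i 1) > 0"
    using assms unfolding positive_definite_def by (simp add: axis_eq_0_iff)
  then show ?thesis
    by (simp add: diag_matrix_vector_mult inner_axis')
qed

lemma matrix_inv_diag_matrix:
  fixes v :: "real ^ 'n"
  assumes "\<And>i. v $ i \<noteq> 0"
  shows "matrix_inv (diag_matrix v) = diag_matrix (\<chi> i. inverse (v $ i))"
proof -
  have mat: "diag_matrix x ** diag_matrix y = mat 1" if "\<And>i. x $ i * y $ i = 1"
    for x y :: "real ^ 'n"
    unfolding matrix_eq
    by (simp add: diag_matrix_vector_mult vec_eq_iff that mult.assoc[symmetric]
        flip: matrix_vector_mul_assoc)
  let ?D = "diag_matrix v" and ?E = "diag_matrix (\<chi> i. inverse (v $ i))"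
  have "?D ** ?E = mat 1" and ED: "?E ** ?D = mat 1"
    using assms by (auto intro: mat)
  \<comment> \<open>\<open>matrix_inv\<close> is a choice among two-sided inverses;
    \<open>?E\<close> witnesses that one exists, and associativity below identifies the chosen one
    with \<open>?E\<close>.\<close>
  then have right_inv: "?D ** matrix_inv ?D = mat 1"
    unfolding matrix_inv_def by - (rule someI2[of _ ?E], auto)
  have "matrix_inv ?D = (?E ** ?D) ** matrix_inv ?D" by (simp add: ED)
  also have "\<dots> = ?E"
    by (simp add: right_inv flip: matrix_mul_assoc)
  finally show ?thesis .
qed

lemma bij_betw_axis_Basis: "bij_betw (\<lambda>i. axis i 1) UNIV (Basis :: (real ^ 'n) set)"
  by (auto simp: bij_betw_def inj_on_def Basis_vec_def axis_eq_axis)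

lemmas sum_Basis_vec = sum.reindex_bij_betw[OF bij_betw_axis_Basis, symmetric]
lemmas prod_Basis_vec = prod.reindex_bij_betw[OF bij_betw_axis_Basis, symmetric]

text \<open>The two densities agree: the determinant is the product of the variances and the
  quadratic form is a sum over coordinates. For b = \<open>axis i 1\<close>,
  \<open>v \<bullet> b\<close> is the variance \<open>v $ i\<close>.\<close>

lemma multivariate_normal_diag_matrix:
  fixes v :: "real ^ 'n"
  assumes v: "\<And>i. 0 < v $ i"
  shows "multivariate_normal 0 (diag_matrix v) = diag_normal (\<lambda>b. sqrt (v \<bullet> b))"
proof -
  have nz: "v $ i \<noteq> 0" for i using v[of i] by simp
  have "exp (- (x \<bullet> (matrix_inv (diag_matrix v) *v x)) / 2)
        / sqrt ((2 * pi) ^ CARD('n) * det (diag_matrix v))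
      = (\<Prod>i\<in>UNIV. normal_density 0 (sqrt (v $ i)) (x $ i))" for x
  proof -
    have "det (diag_matrix v) = (\<Prod>i\<in>UNIV. v $ i)"
      by (subst det_diagonal) (auto simp: diag_matrix_def)
    moreover have "sqrt (prod f A) = (\<Prod>i\<in>A. sqrt (f i))" for f and A :: "'n set"
      by (induction A rule: infinite_finite_induct) (simp_all add: real_sqrt_mult)
    ultimately have "(\<Prod>i\<in>UNIV. sqrt (2 * pi * v $ i)) = sqrt ((2 * pi) ^ CARD('n) * det (diag_matrix v))"
      by (simp add: prod.distrib real_sqrt_mult real_sqrt_power power_mult_distrib)
    moreover have "(\<Prod>i\<in>UNIV. exp (- (x $ i)\<^sup>2 / (2 * v $ i)))
        = exp (- (x \<bullet> (matrix_inv (diag_matrix v) *v x)) / 2)"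
      by (simp add: matrix_inv_diag_matrix[OF nz] inner_diag_matrix exp_sum[symmetric]
          sum_negf[symmetric] sum_divide_distrib field_simps power2_eq_square)
    ultimately show ?thesis
      using v by (simp add: normal_density_def prod.distrib prod_dividef less_imp_le)
  qed
  then show ?thesis
    unfolding multivariate_normal_def diag_normal_def
    by (simp add: prod_Basis_vec inner_axis)
qed

lemma multivariate_normal_fourth_moment:
  fixes v w :: "real ^ 'n"
  assumes v: "\<And>i. 0 < v $ i"
  shows "has_bochner_integral (multivariate_normal 0 (diag_matrix v)) (\<lambda>x. (x \<bullet> w) ^ 4)
    (3 * (w \<bullet> (diag_matrix v *v w))\<^sup>2)"
proof -
  have "0 < sqrt (v \<bullet> b)" if "b \<in> Basis" for b
    using that v by (auto simp: Basis_vec_def inner_axis)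
  from diag_normal_fourth_moment[of "\<lambda>b. sqrt (v \<bullet> b)", OF this, of w] show ?thesis
    using v by (simp add: multivariate_normal_diag_matrix sum_Basis_vec inner_axis
        inner_diag_matrix less_imp_le power2_eq_square mult.assoc)
qed

section \<open>The loss as a quartic polynomial, and its gradient\<close>

lemma population_loss_diag_matrix:
  fixes v :: "real ^ 'n"
  assumes v: "\<And>i. 0 < v $ i"
  defines "B \<equiv> \<lambda>x y. x \<bullet> (diag_matrix v *v y)"
  shows "population_loss (diag_matrix v) z w
    = 3 * (B w w)\<^sup>2 - 2 * B z z * B w w - 4 * (B w z)\<^sup>2 + 3 * (B z z)\<^sup>2"
proof -
  have moment: "has_bochner_integral (multivariate_normal 0 (diag_matrix v)) (\<lambda>x. (x \<bullet> y) ^ 4)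
      (3 * (B y y)\<^sup>2)" for y
    unfolding B_def using v by (rule multivariate_normal_fourth_moment)
  have sym: "B x y = B y x" for x y
    by (simp add: B_def inner_diag_matrix mult_ac)
  have lin: "B (x + y) (x + y) = B x x + B y y + 2 * B x y"
    "B (x - y) (x - y) = B x x + B y y - 2 * B x y" for x y
    using sym[of x y]
    by (simp_all add: B_def inner_add_left inner_add_right inner_diff_left inner_diff_right
        matrix_vector_right_distrib matrix_vector_mult_diff_distrib)
  \<comment> \<open>From (a + b)^4 + (a - b)^4 = 2 a^4 + 12 a^2 b^2 + 2 b^4, the mixed term -2 a^2
    b^2 equals (a^4 + b^4) / 3 minus one sixth of the left-hand side.\<close>
  have "(a\<^sup>2 - b\<^sup>2)\<^sup>2 = 4 / 3 * a ^ 4 + 4 / 3 * b ^ 4 - 1 / 6 * (a + b) ^ 4 - 1 / 6 * (a - b) ^ 4"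
    for a b :: real
    by (simp add: eval_nat_numeral field_simps)
  then have polar: "((x \<bullet> w)\<^sup>2 - (x \<bullet> z)\<^sup>2)\<^sup>2 = 4 / 3 * (x \<bullet> w) ^ 4 + 4 / 3 * (x \<bullet> z) ^ 4
      - 1 / 6 * (x \<bullet> (w + z)) ^ 4 - 1 / 6 * (x \<bullet> (w - z)) ^ 4" for x :: "real ^ 'n"
    by (simp add: inner_add_right inner_diff_right)
  have "has_bochner_integral (multivariate_normal 0 (diag_matrix v))
    (\<lambda>x. ((x \<bullet> w)\<^sup>2 - (x \<bullet> z)\<^sup>2)\<^sup>2)
    (4 / 3 * (3 * (B w w)\<^sup>2) + 4 / 3 * (3 * (B z z)\<^sup>2)
      - 1 / 6 * (3 * (B (w + z) (w + z))\<^sup>2) - 1 / 6 * (3 * (B (w - z) (w - z))\<^sup>2))"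
    unfolding polar
    by (intro has_bochner_integral_add has_bochner_integral_diff
        has_bochner_integral_mult_right moment)
  then have "population_loss (diag_matrix v) z w = 4 / 3 * (3 * (B w w)\<^sup>2) + 4 / 3 * (3 * (B z z)\<^sup>2)
      - 1 / 6 * (3 * (B (w + z) (w + z))\<^sup>2) - 1 / 6 * (3 * (B (w - z) (w - z))\<^sup>2)"
    unfolding population_loss_def by (rule has_bochner_integral_integral_eq)
  also have "\<dots> = 3 * (B w w)\<^sup>2 - 2 * B z z * B w w - 4 * (B w z)\<^sup>2 + 3 * (B z z)\<^sup>2"
    unfolding lin by (simp add: power2_eq_square algebra_simps)
  finally show ?thesis .
qed

lemma gradient_population_loss_diag_matrix:
  fixes v :: "real ^ 'n"
  assumes v: "\<And>i. 0 < v $ i"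
  defines "Q \<equiv> diag_matrix v"
  shows "gradient (population_loss Q z) w
    = (12 * (w \<bullet> (Q *v w)) - 4 * (z \<bullet> (Q *v z))) *\<^sub>R (Q *v w) - (8 * (w \<bullet> (Q *v z))) *\<^sub>R (Q *v z)"
proof (rule gradient_eqI)
  have sym: "x \<bullet> (Q *v y) = y \<bullet> (Q *v x)" for x y
    by (simp add: Q_def inner_diag_matrix mult_ac)
  have loss: "population_loss Q z = (\<lambda>w. 3 * (w \<bullet> (Q *v w))\<^sup>2
      - 2 * (z \<bullet> (Q *v z)) * (w \<bullet> (Q *v w)) - 4 * (w \<bullet> (Q *v z))\<^sup>2 + 3 * (z \<bullet> (Q *v z))\<^sup>2)"
    by (simp add: fun_eq_iff Q_def population_loss_diag_matrix[OF v])
  have Q: "((\<lambda>w. Q *v w) has_derivative (\<lambda>h. Q *v h)) (at w)"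
    by (rule bounded_linear_imp_has_derivative) (rule matrix_vector_mul_bounded_linear)
  \<comment> \<open>The two terms of the product rule coincide because \<open>Q\<close> is
    symmetric.\<close>
  have quad: "((\<lambda>w. w \<bullet> (Q *v w)) has_derivative (\<lambda>h. 2 * (h \<bullet> (Q *v w)))) (at w)"
    by (rule has_derivative_eq_rhs[OF has_derivative_inner[OF has_derivative_ident Q]])
      (simp add: fun_eq_iff sym)
  have lin: "((\<lambda>w. w \<bullet> (Q *v z)) has_derivative (\<lambda>h. h \<bullet> (Q *v z))) (at w)"
    by (rule has_derivative_inner_left) (rule has_derivative_ident)
  show "GDERIV (population_loss Q z) w :> (12 * (w \<bullet> (Q *v w)) - 4 * (z \<bullet> (Q *v z))) *\<^sub>R (Q *v w)
      - (8 * (w \<bullet> (Q *v z))) *\<^sub>R (Q *v z)"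
    unfolding gderiv_def loss
    by (rule derivative_eq_intros quad lin refl)+
      (simp add: fun_eq_iff inner_diff_right algebra_simps)
qed

section \<open>The flow equations\<close>

theorem proposition3:
  fixes lam wstar :: "real ^ 'd" and Q :: "real ^ 'd ^ 'd"
    and w :: "real \<Rightarrow> real ^ 'd" and T :: "real set"
    and s u :: "nat \<Rightarrow> real \<Rightarrow> real" and sstar :: "nat \<Rightarrow> real"
  defines "Q \<equiv> diag_matrix lam"
  defines "s \<equiv> \<lambda>k t. w t \<bullet> (matrix_power Q k *v w t)"
    and "sstar \<equiv> \<lambda>k. wstar \<bullet> (matrix_power Q k *v wstar)"
    and "u \<equiv> \<lambda>k t. w t \<bullet> (matrix_power Q k *v wstar)"
  assumes Q_pos: "positive_definite Q"
    and T: "is_interval T"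
    and flow: "\<And>t. t \<in> T \<Longrightarrow>
      (w has_vector_derivative - gradient (population_loss Q wstar) (w t)) (at t within T)"
  shows "\<forall>t\<in>T.
    (\<forall>i. ((\<lambda>\<tau>. w \<tau> $ i) has_real_derivative
        4 * lam $ i * (sstar 1 - 3 * s 1 t) * w t $ i + 8 * lam $ i * u 1 t * wstar $ i)
        (at t within T)) \<and>
    (\<forall>k\<ge>1.
      (s k has_real_derivative
        8 * (sstar 1 - 3 * s 1 t) * s (k + 1) t + 16 * u 1 t * u (k + 1) t) (at t within T) \<and>
      (u k has_real_derivative
        4 * (sstar 1 - 3 * s 1 t) * u (k + 1) t + 8 * u 1 t * sstar (k + 1)) (at t within T))"
proof (intro ballI conjI allI impI)
  fix t assume t: "t \<in> T"
  let ?c = "sstar 1 - 3 * s 1 t"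
  have lam: "0 < lam $ i" for i
    using positive_definite_diag_matrixD[OF Q_pos[unfolded Q_def]] .
  show w: "((\<lambda>\<tau>. w \<tau> $ i) has_real_derivative
        4 * lam $ i * ?c * w t $ i + 8 * lam $ i * u 1 t * wstar $ i) (at t within T)" for i
  proof -
    have "((\<lambda>\<tau>. w \<tau> $ i) has_real_derivative
        (- gradient (population_loss Q wstar) (w t)) $ i) (at t within T)"
      unfolding has_real_derivative_iff_has_vector_derivative
      using bounded_linear.has_vector_derivative[OF bounded_linear_vec_nth flow[OF t]] .
    also have "(- gradient (population_loss Q wstar) (w t)) $ i
        = 4 * lam $ i * ?c * w t $ i + 8 * lam $ i * u 1 t * wstar $ i"
      unfolding Q_def gradient_population_loss_diag_matrix[OF lam]
      by (simp add: s_def sstar_def u_def Q_def diag_matrix_vector_mult algebra_simps)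
    finally show ?thesis .
  qed
  \<comment> \<open>In coordinates, every term of the equation for \<open>w \<tau> $ i\<close>
    carries a factor \<open>lam $ i\<close>; it raises the weight \<open>lam $ i ^ k\<close> to
    \<open>lam $ i ^ (k + 1)\<close>, whence the shifted index on the right-hand sides.\<close>
  have s: "s k = (\<lambda>\<tau>. \<Sum>i\<in>UNIV. lam $ i ^ k * w \<tau> $ i * w \<tau> $ i)"
    and u: "u k = (\<lambda>\<tau>. \<Sum>i\<in>UNIV. lam $ i ^ k * w \<tau> $ i * wstar $ i)"
    and sstar: "sstar k = (\<Sum>i\<in>UNIV. lam $ i ^ k * wstar $ i * wstar $ i)" for k
    by (simp_all add: s_def u_def sstar_def Q_def inner_matrix_power_diag_matrix)
  fix k :: nat
  show "(s k has_real_derivative 8 * ?c * s (k + 1) t + 16 * u 1 t * u (k + 1) t) (at t within T)"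
    \<comment> \<open>Merging the right-hand side into a single sum over i reduces the claim to an
      identity for each summand.\<close>
    unfolding s[of k] s[of "k + 1"] u[of "k + 1"] sum_distrib_left sum.distrib[symmetric]
    by (intro DERIV_sum DERIV_cong[OF DERIV_mult[OF DERIV_cmult[OF w] w]]) (simp add: algebra_simps)
  show "(u k has_real_derivative 4 * ?c * u (k + 1) t + 8 * u 1 t * sstar (k + 1)) (at t within T)"
    unfolding u[of k] u[of "k + 1"] sstar[of "k + 1"] sum_distrib_left sum.distrib[symmetric]
    by (intro DERIV_sum DERIV_cong[OF DERIV_cmult_right[OF DERIV_cmult[OF w]]])
      (simp add: algebra_simps)
qed

end
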